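(* Let $(A,\sigma)$ be a state BL-algebra with $A$ nontrivial ($0\neq1$). Then the set $\mathcal S_{\mathrm{com}}(A,\sigma)$ of $\sigma$-compatible states on $A$ is nonempty, and it is affinely homeomorphic (i.e. via a homeomorphism, in the weak topologies, preserving convex combinations) to the set $\mathcal S(\sigma(A))$ of all states on the BL-algebra $\sigma(A)$.
   Context: A BL-algebra is an algebra $(A,\wedge,\vee,\odot,\to,0,1)$ of type $(2,2,2,2,0,0)$ such that $(A,\wedge,\vee,0,1)$ is a bounded lattice, $(A,\odot,1)$ is a commutative monoid, and for all $a,b,c\in A$: $c\le a\to b$ iff $a\odot c\le b$; $a\wedge b=a\odot(a\to b)$; $(a\to b)\vee(b\to a)=1$. A state-operator on $A$ is a map $\sigma:A\to A$ such that for all $x,y\in A$: (1) $\sigma(0)=0$; (2) $\sigma(x\to y)=\sigma(x)\to\sigma(x\wedge y)$; (3) $\sigma(x\odot y)=\sigma(x)\odot\sigma(x\to x\odot y)$; (4) $\sigma(\sigma(x)\odot\sigma(y))=\sigma(x)\odot\sigma(y)$; (5) $\sigma(\sigma(x)\to\sigma(y))=\sigma(x)\to\sigma(y)$. The image $\sigma(A)$ is a subalgebra of $A$, regarded as a BL-algebra. A state on a BL-algebra $B$ is a map $s:B\to[0,1]$ with $s(0)=0$, $s(1)=1$ and $s(x)+s(x\to y)=s(y)+s(y\to x)$ for all $x,y$. A state $s$ on $A$ is $\sigma$-compatible if $\sigma(x)=\sigma(y)$ implies $s(x)=s(y)$. Sets of states carry the weak topology: a net $s_\alpha$ converges to $s$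 iff $s_\alpha(x)\to s(x)$ for every $x$. *)

theory Defs
  imports "HOL-Analysis.Analysis" "HOL-Algebra.Group"
begin

text \<open>The unit of the underlying \<^typ>\<open>'a monoid\<close> is also the top element of the lattice, as in the
  signature \<open>(2,2,2,2,0,0)\<close>.\<close>

record 'a bl_structure = "'a monoid" +
  bl_meet :: "'a \<Rightarrow> 'a \<Rightarrow> 'a" (infixl \<open>\<curlywedge>\<index>\<close> 70)
  bl_join :: "'a \<Rightarrow> 'a \<Rightarrow> 'a" (infixl \<open>\<curlyvee>\<index>\<close> 65)
  bl_imp :: "'a \<Rightarrow> 'a \<Rightarrow> 'a" (infixr \<open>\<leadsto>\<index>\<close> 60)
  bl_zero :: 'a (\<open>\<zero>\<index>\<close>)

definition bl_le :: "('a, 'm) bl_structure_scheme \<Rightarrow> 'a \<Rightarrow> 'a \<Rightarrow> bool" (infix \<open>\<preceq>\<index>\<close> 50)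
  where "a \<preceq>\<^bsub>A\<^esub> b \<longleftrightarrow> a \<curlywedge>\<^bsub>A\<^esub> b = a"

locale bl_algebra = comm_monoid A for A (structure) +
  assumes meet_closed: "\<lbrakk>a \<in> carrier A; b \<in> carrier A\<rbrakk> \<Longrightarrow> a \<curlywedge> b \<in> carrier A"
    and join_closed: "\<lbrakk>a \<in> carrier A; b \<in> carrier A\<rbrakk> \<Longrightarrow> a \<curlyvee> b \<in> carrier A"
    and imp_closed: "\<lbrakk>a \<in> carrier A; b \<in> carrier A\<rbrakk> \<Longrightarrow> a \<leadsto> b \<in> carrier A"
    and zero_closed: "\<zero> \<in> carrier A"
    and meet_assoc: "\<lbrakk>a \<in> carrier A; b \<in> carrier A; c \<in> carrier A\<rbrakk>
      \<Longrightarrow> (a \<curlywedge> b) \<curlywedge> c = a \<curlywedge> (b \<curlywedge> c)"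
    and join_assoc: "\<lbrakk>a \<in> carrier A; b \<in> carrier A; c \<in> carrier A\<rbrakk>
      \<Longrightarrow> (a \<curlyvee> b) \<curlyvee> c = a \<curlyvee> (b \<curlyvee> c)"
    and meet_comm: "\<lbrakk>a \<in> carrier A; b \<in> carrier A\<rbrakk> \<Longrightarrow> a \<curlywedge> b = b \<curlywedge> a"
    and join_comm: "\<lbrakk>a \<in> carrier A; b \<in> carrier A\<rbrakk> \<Longrightarrow> a \<curlyvee> b = b \<curlyvee> a"
    and meet_absorb: "\<lbrakk>a \<in> carrier A; b \<in> carrier A\<rbrakk> \<Longrightarrow> a \<curlywedge> (a \<curlyvee> b) = a"
    and join_absorb: "\<lbrakk>a \<in> carrier A; b \<in> carrier A\<rbrakk> \<Longrightarrow> a \<curlyvee> (a \<curlywedge> b) = a"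
    and zero_least: "a \<in> carrier A \<Longrightarrow> \<zero> \<preceq> a"
    and one_greatest: "a \<in> carrier A \<Longrightarrow> a \<preceq> \<one>"
    and residuation: "\<lbrakk>a \<in> carrier A; b \<in> carrier A; c \<in> carrier A\<rbrakk>
      \<Longrightarrow> c \<preceq> a \<leadsto> b \<longleftrightarrow> a \<otimes> c \<preceq> b"
    and divisibility: "\<lbrakk>a \<in> carrier A; b \<in> carrier A\<rbrakk> \<Longrightarrow> a \<curlywedge> b = a \<otimes> (a \<leadsto> b)"
    and prelinearity: "\<lbrakk>a \<in> carrier A; b \<in> carrier A\<rbrakk> \<Longrightarrow> (a \<leadsto> b) \<curlyvee> (b \<leadsto> a) = \<one>"

locale state_bl_algebra = bl_algebra A for A (structure) +
  fixes \<sigma> :: "'a \<Rightarrow> 'a"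
  assumes sigma_closed: "x \<in> carrier A \<Longrightarrow> \<sigma> x \<in> carrier A"
    and sigma_zero: "\<sigma> \<zero> = \<zero>"
    and sigma_imp: "\<lbrakk>x \<in> carrier A; y \<in> carrier A\<rbrakk> \<Longrightarrow> \<sigma> (x \<leadsto> y) = \<sigma> x \<leadsto> \<sigma> (x \<curlywedge> y)"
    and sigma_mult: "\<lbrakk>x \<in> carrier A; y \<in> carrier A\<rbrakk>
      \<Longrightarrow> \<sigma> (x \<otimes> y) = \<sigma> x \<otimes> \<sigma> (x \<leadsto> x \<otimes> y)"
    and sigma_sigma_mult: "\<lbrakk>x \<in> carrier A; y \<in> carrier A\<rbrakk>
      \<Longrightarrow> \<sigma> (\<sigma> x \<otimes> \<sigma> y) = \<sigma> x \<otimes> \<sigma> y"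
    and sigma_sigma_imp: "\<lbrakk>x \<in> carrier A; y \<in> carrier A\<rbrakk>
      \<Longrightarrow> \<sigma> (\<sigma> x \<leadsto> \<sigma> y) = \<sigma> x \<leadsto> \<sigma> y"

definition image_algebra ::
    "('a, 'm) bl_structure_scheme \<Rightarrow> ('a \<Rightarrow> 'a) \<Rightarrow> ('a, 'm) bl_structure_scheme"
  where "image_algebra A \<sigma> = A\<lparr>carrier := \<sigma> ` carrier A\<rparr>"

text \<open>States are extensional functions (\<^const>\<open>undefined\<close> off the carrier), so that distinct
  elements of the set below are distinct as maps \<open>B \<rightarrow> [0,1]\<close>.\<close>

definition states :: "('a, 'm) bl_structure_scheme \<Rightarrow> ('a \<Rightarrow> real) set"
  where "states B = {s \<in> carrier B \<rightarrow>\<^sub>E {0..1}. s \<zero>\<^bsub>B\<^esub> = 0 \<and> s \<one>\<^bsub>B\<^esub> = 1 \<and>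
    (\<forall>x \<in> carrier B. \<forall>y \<in> carrier B. s x + s (x \<leadsto>\<^bsub>B\<^esub> y) = s y + s (y \<leadsto>\<^bsub>B\<^esub> x))}"

definition compatible_states ::
    "('a, 'm) bl_structure_scheme \<Rightarrow> ('a \<Rightarrow> 'a) \<Rightarrow> ('a \<Rightarrow> real) set"
  where "compatible_states A \<sigma> =
    {s \<in> states A. \<forall>x \<in> carrier A. \<forall>y \<in> carrier A. \<sigma> x = \<sigma> y \<longrightarrow> s x = s y}"

text \<open>The topology of pointwise convergence on the carrier.\<close>

definition weak_topology ::
    "('a, 'm) bl_structure_scheme \<Rightarrow> ('a \<Rightarrow> real) set \<Rightarrow> ('a \<Rightarrow> real) topology"
  where "weak_topology B S = subtopology (product_topology (\<lambda>_. euclideanreal) (carrier B)) S"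

definition convex_comb ::
    "('a, 'm) bl_structure_scheme \<Rightarrow> real \<Rightarrow> ('a \<Rightarrow> real) \<Rightarrow> ('a \<Rightarrow> real) \<Rightarrow> 'a \<Rightarrow> real"
  where "convex_comb B r s t = (\<lambda>x \<in> carrier B. r * s x + (1 - r) * t x)"

definition affine_homeomorphism ::
    "('a, 'm) bl_structure_scheme \<Rightarrow> ('a \<Rightarrow> real) set \<Rightarrow>
     ('b, 'n) bl_structure_scheme \<Rightarrow> ('b \<Rightarrow> real) set \<Rightarrow>
     (('a \<Rightarrow> real) \<Rightarrow> 'b \<Rightarrow> real) \<Rightarrow> bool"
  where "affine_homeomorphism B S C T \<Phi> \<longleftrightarrow>
    homeomorphic_map (weak_topology B S) (weak_topology C T) \<Phi> \<and>
    (\<forall>s \<in> S. \<forall>t \<in> S. \<forall>r \<in> {0..1}.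
      \<Phi> (convex_comb B r s t) = convex_comb C r (\<Phi> s) (\<Phi> t))"

lemma limitin_weak_topology:
  assumes "S \<subseteq> extensional (carrier B)"
  shows "limitin (weak_topology B S) f s F \<longleftrightarrow>
    s \<in> S \<and> (\<forall>\<^sub>F i in F. f i \<in> S) \<and> (\<forall>x \<in> carrier B. ((\<lambda>i. f i x) \<longlongrightarrow> s x) F)"
proof -
  have "\<forall>\<^sub>F i in F. f i \<in> extensional (carrier B)" if "\<forall>\<^sub>F i in F. f i \<in> S"
    using that by (rule eventually_mono) (use assms in auto)
  with assms show ?thesis
    unfolding weak_topology_def limitin_subtopology limitin_componentwise limitin_canonical_iff
    by (auto simp: PiE_def)
qed

lemma convex_comb_states:
  assumes "s \<in> states B" "t \<in> states B" "r \<in> {0..1}" "bl_algebra B"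
  shows "convex_comb B r s t \<in> states B"
proof -
  interpret bl_algebra B by fact
  have "convex_comb B r s t x \<in> {0..1}" if "x \<in> carrier B" for x
  proof -
    have "s x \<in> {0..1}" "t x \<in> {0..1}" using assms that by (auto simp: states_def)
    then have "r * s x + (1 - r) * t x \<in> {0..1}"
      using assms(3) convexD_alt[OF convex_real_interval(5)[of 0 1], of "t x" "s x" r]
      by (simp add: algebra_simps)
    then show ?thesis using that by (simp add: convex_comb_def)
  qed
  moreover have "convex_comb B r s t x + convex_comb B r s t (x \<leadsto>\<^bsub>B\<^esub> y)
      = convex_comb B r s t y + convex_comb B r s t (y \<leadsto>\<^bsub>B\<^esub> x)"
    if "x \<in> carrier B" "y \<in> carrier B" for x y
  proof -
    have "s x + s (x \<leadsto>\<^bsub>B\<^esub> y) = s y + s (y \<leadsto>\<^bsub>B\<^esub> x)" "t x + t (x \<leadsto>\<^bsub>B\<^esub> y) = t y + t (y \<leadsto>\<^bsub>B\<^esub> x)"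
      using assms that by (auto simp: states_def)
    then have "r * (s x + s (x \<leadsto>\<^bsub>B\<^esub> y)) + (1 - r) * (t x + t (x \<leadsto>\<^bsub>B\<^esub> y))
       = r * (s y + s (y \<leadsto>\<^bsub>B\<^esub> x)) + (1 - r) * (t y + t (y \<leadsto>\<^bsub>B\<^esub> x))" by simp
    then show ?thesis using that by (simp add: convex_comb_def imp_closed algebra_simps)
  qed
  ultimately show ?thesis
    using assms by (auto simp: states_def convex_comb_def zero_closed extensional_def)
qed

lemma convex_comb_compatible_states:
  assumes "s \<in> compatible_states A \<sigma>" "t \<in> compatible_states A \<sigma>" "r \<in> {0..1}" "bl_algebra A"
  shows "convex_comb A r s t \<in> compatible_states A \<sigma>"
proof -
  have "convex_comb A r s t \<in> states A"
    using assms by (intro convex_comb_states) (auto simp: compatible_states_def)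
  moreover have "convex_comb A r s t x = convex_comb A r s t y"
    if "x \<in> carrier A" "y \<in> carrier A" "\<sigma> x = \<sigma> y" for x y
  proof -
    have "s x = s y" "t x = t y"
      using assms(1,2) that unfolding compatible_states_def by blast+
    then show ?thesis
      using that by (simp add: convex_comb_def)
  qed
  ultimately show ?thesis
    unfolding compatible_states_def by blast
qed

context bl_algebra
begin

lemma le_refl: "a \<in> carrier A \<Longrightarrow> a \<preceq> a"
  by (metis bl_le_def join_absorb meet_absorb meet_closed)

lemma le_antisym: "\<lbrakk>a \<in> carrier A; b \<in> carrier A; a \<preceq> b; b \<preceq> a\<rbrakk> \<Longrightarrow> a = b"
  by (metis bl_le_def meet_comm)

lemma le_trans: "\<lbrakk>a \<in> carrier A; b \<in> carrier A; c \<in> carrier A; a \<preceq> b; b \<preceq> c\<rbrakk> \<Longrightarrow> a \<preceq> c"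
  by (metis bl_le_def meet_assoc)

lemma le_iff_join: "\<lbrakk>a \<in> carrier A; b \<in> carrier A\<rbrakk> \<Longrightarrow> a \<preceq> b \<longleftrightarrow> a \<curlyvee> b = b"
  by (metis bl_le_def join_absorb join_comm meet_absorb meet_comm)

lemma le_join1: "\<lbrakk>a \<in> carrier A; b \<in> carrier A\<rbrakk> \<Longrightarrow> a \<preceq> a \<curlyvee> b"
  by (simp add: bl_le_def meet_absorb)

lemma le_join2: "\<lbrakk>a \<in> carrier A; b \<in> carrier A\<rbrakk> \<Longrightarrow> b \<preceq> a \<curlyvee> b"
  by (metis join_comm le_join1)

lemma join_least:
  "\<lbrakk>a \<in> carrier A; b \<in> carrier A; c \<in> carrier A; a \<preceq> c; b \<preceq> c\<rbrakk> \<Longrightarrow> a \<curlyvee> b \<preceq> c"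
  by (metis join_assoc join_closed le_iff_join)

lemma meet_le1: "\<lbrakk>a \<in> carrier A; b \<in> carrier A\<rbrakk> \<Longrightarrow> a \<curlywedge> b \<preceq> a"
  by (metis join_absorb join_comm le_iff_join meet_closed)

lemma meet_le2: "\<lbrakk>a \<in> carrier A; b \<in> carrier A\<rbrakk> \<Longrightarrow> a \<curlywedge> b \<preceq> b"
  by (metis meet_comm meet_le1)

lemma meet_greatest:
  "\<lbrakk>a \<in> carrier A; b \<in> carrier A; c \<in> carrier A; c \<preceq> a; c \<preceq> b\<rbrakk> \<Longrightarrow> c \<preceq> a \<curlywedge> b"
  by (metis bl_le_def meet_assoc)

lemma imp_self: "a \<in> carrier A \<Longrightarrow> a \<leadsto> a = \<one>"
  by (metis imp_closed le_antisym le_refl one_closed one_greatest r_one residuation)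

lemma mult_le1:
  assumes "a \<in> carrier A" "b \<in> carrier A" shows "a \<otimes> b \<preceq> a"
  using residuation[of a a b] imp_self[of a] one_greatest[of b] assms by simp

lemma join_eq:
  assumes x: "x \<in> carrier A" and y: "y \<in> carrier A"
  shows "x \<curlyvee> y = ((x \<leadsto> y) \<leadsto> y) \<curlywedge> ((y \<leadsto> x) \<leadsto> x)" (is "_ = ?u")
proof -
  have upper: "x \<curlyvee> y \<preceq> (x \<leadsto> y) \<leadsto> y" if x: "x \<in> carrier A" and y: "y \<in> carrier A" for x y
  proof (rule join_least)
    have "x \<otimes> (x \<leadsto> y) \<preceq> y"
      using residuation[of x y "x \<leadsto> y"] x y by (simp add: imp_closed le_refl)
    then show "x \<preceq> (x \<leadsto> y) \<leadsto> y"
      using x y by (simp add: residuation imp_closed m_comm)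
    show "y \<preceq> (x \<leadsto> y) \<leadsto> y"
      using x y mult_le1[of y "x \<leadsto> y"] by (simp add: residuation imp_closed m_comm)
  qed (use x y in \<open>auto simp: imp_closed\<close>)
  have lower: "z \<preceq> ?u \<leadsto> (x \<curlyvee> y)"
    if "z = x \<leadsto> y \<and> w = y \<or> z = y \<leadsto> x \<and> w = x" for z w
  proof -
    have cl: "z \<in> carrier A" "w \<in> carrier A" "?u \<in> carrier A" "x \<curlyvee> y \<in> carrier A"
      using that x y by (auto simp: imp_closed meet_closed join_closed)
    have "?u \<preceq> z \<leadsto> w"
      using that x y by (auto simp: imp_closed meet_le1 meet_le2)
    then have "?u \<otimes> z \<preceq> w"
      using cl by (simp add: residuation m_comm)
    moreover have "w \<preceq> x \<curlyvee> y"
      using that x y by (auto simp: le_join1 le_join2)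
    ultimately have "?u \<otimes> z \<preceq> x \<curlyvee> y"
      using cl le_trans[of "?u \<otimes> z" w "x \<curlyvee> y"] by simp
    then show ?thesis
      using cl by (simp add: residuation)
  qed
  have cl: "?u \<in> carrier A" "x \<curlyvee> y \<in> carrier A" "x \<leadsto> y \<in> carrier A" "y \<leadsto> x \<in> carrier A"
    using x y by (auto simp: imp_closed meet_closed join_closed)
  have "(x \<leadsto> y) \<curlyvee> (y \<leadsto> x) \<preceq> ?u \<leadsto> (x \<curlyvee> y)"
    using lower cl by (intro join_least) (auto simp: imp_closed)
  then have "?u \<preceq> x \<curlyvee> y"
    using residuation[of ?u "x \<curlyvee> y" \<one>] cl x y by (simp add: prelinearity)
  moreover have "x \<curlyvee> y \<preceq> ?u"
    using upper[OF x y] upper[OF y x] x y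
    by (intro meet_greatest) (auto simp: imp_closed join_closed join_comm)
  ultimately show ?thesis
    using cl le_antisym by blast
qed

end

lemma (in state_bl_algebra) bl_algebra_image: "bl_algebra (image_algebra A \<sigma>)"
proof -
  have sub: "a \<in> carrier A" if "a \<in> \<sigma> ` carrier A" for a
    using that sigma_closed by auto
  have mult: "a \<otimes> b \<in> \<sigma> ` carrier A" if "a \<in> \<sigma> ` carrier A" "b \<in> \<sigma> ` carrier A" for a b
    using that by clarify
      (rule image_eqI[where f = \<sigma>, OF sigma_sigma_mult[symmetric]], auto simp: m_closed sigma_closed)
  have imp: "a \<leadsto> b \<in> \<sigma> ` carrier A" if "a \<in> \<sigma> ` carrier A" "b \<in> \<sigma> ` carrier A" for a b
    using that by clarify
      (rule image_eqI[where f = \<sigma>, OF sigma_sigma_imp[symmetric]], auto simp: imp_closed sigma_closed)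
  have meet: "a \<curlywedge> b \<in> \<sigma> ` carrier A" if "a \<in> \<sigma> ` carrier A" "b \<in> \<sigma> ` carrier A" for a b
    using that mult imp by (simp add: divisibility sub)
  have join: "a \<curlyvee> b \<in> \<sigma> ` carrier A" if "a \<in> \<sigma> ` carrier A" "b \<in> \<sigma> ` carrier A" for a b
    using that meet imp by (simp add: join_eq sub)
  have zero: "\<zero> \<in> \<sigma> ` carrier A"
    using sigma_zero zero_closed by (metis imageI)
  have one: "\<one> \<in> \<sigma> ` carrier A"
    using imp[OF zero zero] imp_self zero_closed by simp
  have le: "a \<preceq>\<^bsub>A\<lparr>carrier := \<sigma> ` carrier A\<rparr>\<^esub> b \<longleftrightarrow> a \<preceq> b" for a b
    by (simp add: bl_le_def)
  show ?thesis
    unfolding image_algebra_def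
    by unfold_locales
      (simp_all add: le mult imp meet join zero one sub m_assoc meet_assoc join_assoc
        meet_absorb join_absorb zero_least one_greatest residuation prelinearity,
       simp_all add: sub m_comm meet_comm join_comm divisibility)
qed

end

theory Submission
  imports Defs
begin

text \<open>Restricting to \<open>\<sigma>(A)\<close> and composing with \<open>\<sigma>\<close> are mutually inverse, because \<open>\<sigma>\<close> is idempotent
  and \<open>\<sigma>(x \<rightarrow> y) = \<sigma>(x) \<rightarrow> \<sigma>(x \<and> y)\<close> with \<open>\<sigma>(x \<and> y) \<le> \<sigma>(x)\<close>; so everything rests on the
  existence of a state on an arbitrary nontrivial BL-algebra. A maximal filter \<open>F\<close> makes
  \<open>x \<rightarrow> y \<in> F\<close> a total preorder in which every \<open>z \<notin> F\<close> has a power equivalent to \<open>0\<close>. As in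
  Hoelder's theorem, such a \<open>z\<close> serves as a unit of length: if \<open>N\<close> is the least exponent with
  \<open>z\<^sup>N \<sim> 0\<close> and \<open>k(x) \<le> N\<close> the largest with \<open>x \<le> z\<^sup>k\<close>, then \<open>1 - k(x)/N\<close> satisfies the state
  equation up to \<open>2/N\<close>, and exactly if \<open>z\<close> is a coatom. Without a coatom \<open>N\<close> is unbounded, and
  compactness of \<open>[0,1]\<^sup>A\<close> produces a state.\<close>

section \<open>Filters of BL-algebras\<close>

context bl_algebra
begin

lemmas bl_closed [simp] = meet_closed join_closed imp_closed zero_closed

lemma le_iff_imp_eq_one:
  assumes "a \<in> carrier A" "b \<in> carrier A"
  shows "a \<preceq> b \<longleftrightarrow> a \<leadsto> b = \<one>"
  using assms residuation[of a b \<one>] one_greatest[of "a \<leadsto> b"] le_antisym[of "a \<leadsto> b" \<one>]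
  by (auto simp: le_refl)

lemma mult_imp_le:
  assumes "a \<in> carrier A" "b \<in> carrier A"
  shows "a \<otimes> (a \<leadsto> b) \<preceq> b"
  using assms residuation[of a b "a \<leadsto> b"] by (simp add: le_refl)

lemma mult_le2:
  assumes "a \<in> carrier A" "b \<in> carrier A"
  shows "a \<otimes> b \<preceq> b"
  using mult_le1[of b a] assms by (simp add: m_comm)

lemma mult_mono_right:
  assumes "a \<in> carrier A" "b \<in> carrier A" "c \<in> carrier A" "a \<preceq> b"
  shows "c \<otimes> a \<preceq> c \<otimes> b"
proof -
  have "b \<preceq> c \<leadsto> c \<otimes> b"
    using assms residuation[of c "c \<otimes> b" b] by (simp add: le_refl)
  then have "a \<preceq> c \<leadsto> c \<otimes> b"
    using assms le_trans[of a b "c \<leadsto> c \<otimes> b"] by simp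
  then show ?thesis
    using assms residuation by simp
qed

lemma mult_mono:
  assumes "a \<in> carrier A" "b \<in> carrier A" "c \<in> carrier A" "d \<in> carrier A" "a \<preceq> b" "c \<preceq> d"
  shows "a \<otimes> c \<preceq> b \<otimes> d"
proof (rule le_trans)
  show "a \<otimes> c \<preceq> a \<otimes> d"
    using assms by (simp add: mult_mono_right)
  show "a \<otimes> d \<preceq> b \<otimes> d"
    using assms mult_mono_right[of a b d] by (simp add: m_comm)
qed (use assms in auto)

lemma imp_imp:
  assumes "a \<in> carrier A" "b \<in> carrier A" "c \<in> carrier A"
  shows "a \<leadsto> b \<leadsto> c = a \<otimes> b \<leadsto> c"
proof -
  have iff: "d \<preceq> a \<leadsto> b \<leadsto> c \<longleftrightarrow> d \<preceq> a \<otimes> b \<leadsto> c" if "d \<in> carrier A" for d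
    using assms that by (simp add: residuation) (metis m_assoc m_comm)
  show ?thesis
    using iff[of "a \<leadsto> b \<leadsto> c"] iff[of "a \<otimes> b \<leadsto> c"] assms
    by (intro le_antisym) (auto simp: le_refl)
qed

text \<open>Two applications of residuation turn each join on the left into an upper-bound problem
  for its two members. This is what makes the set of w with \<open>w \<curlyvee> v\<close> in F
  closed under products.\<close>

lemma join_mult_join_le:
  assumes x: "x \<in> carrier A" and y: "y \<in> carrier A" and v: "v \<in> carrier A"
  shows "(x \<curlyvee> v) \<otimes> (y \<curlyvee> v) \<preceq> x \<otimes> y \<curlyvee> v"
proof -
  let ?t = "x \<otimes> y \<curlyvee> v"
  have le: "p \<preceq> ?t" if "p \<in> carrier A" "p \<preceq> x \<otimes> y \<or> p \<preceq> v" for p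
    using that x y v le_trans[of p "x \<otimes> y" ?t] le_trans[of p v ?t] by (auto simp: le_join1 le_join2)
  have "x \<preceq> (y \<curlyvee> v) \<leadsto> ?t"
  proof -
    have "y \<curlyvee> v \<preceq> x \<leadsto> ?t"
      using x y v by (intro join_least) (auto simp: residuation le le_refl mult_le2)
    then show ?thesis
      using x y v by (simp add: residuation m_comm)
  qed
  moreover have "v \<preceq> (y \<curlyvee> v) \<leadsto> ?t"
    using x y v by (simp add: residuation le mult_le2)
  ultimately have "x \<curlyvee> v \<preceq> (y \<curlyvee> v) \<leadsto> ?t"
    using x y v by (intro join_least) auto
  then show ?thesis
    using x y v by (simp add: residuation m_comm)
qed

definition bl_filter :: "'a set \<Rightarrow> bool"
  where "bl_filter F \<longleftrightarrow> F \<subseteq> carrier A \<and> \<one> \<in> F \<and> (\<forall>x \<in> F. \<forall>y \<in> F. x \<otimes> y \<in> F) \<and>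
    (\<forall>x \<in> F. \<forall>y \<in> carrier A. x \<preceq> y \<longrightarrow> y \<in> F)"

lemma ex_maximal_filter:
  assumes "\<zero> \<noteq> \<one>"
  obtains F where "bl_filter F" "\<zero> \<notin> F"
    "\<And>G. \<lbrakk>bl_filter G; \<zero> \<notin> G; F \<subseteq> G\<rbrakk> \<Longrightarrow> G = F"
proof -
  define \<F> where "\<F> = {F. bl_filter F \<and> \<zero> \<notin> F}"
  have "\<exists>M\<in>\<F>. \<forall>X\<in>\<F>. M \<subseteq> X \<longrightarrow> X = M"
  proof (rule subset_Zorn_nonempty)
    have "bl_filter {\<one>}"
      unfolding bl_filter_def by (auto intro: le_antisym one_greatest)
    then show "\<F> \<noteq> {}"
      using assms by (auto simp: \<F>_def)
  next
    fix \<C> assume ne: "\<C> \<noteq> {}" and ch: "subset.chain \<F> \<C>"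
    have mult: "x \<otimes> y \<in> \<Union>\<C>" if xy: "x \<in> \<Union>\<C>" "y \<in> \<Union>\<C>" for x y
    proof -
      obtain X Y where XY: "X \<in> \<C>" "Y \<in> \<C>" "x \<in> X" "y \<in> Y"
        using xy by auto
      then have "X \<subseteq> Y \<or> Y \<subseteq> X"
        using ch by (auto simp: subset_chain_def)
      then obtain Z where "Z \<in> \<C>" "x \<in> Z" "y \<in> Z"
        using XY by blast
      moreover have "bl_filter Z"
        using ch \<open>Z \<in> \<C>\<close> by (auto simp: subset_chain_def \<F>_def)
      ultimately show ?thesis
        by (auto simp: bl_filter_def)
    qed
    have fil: "bl_filter X" "\<zero> \<notin> X" if "X \<in> \<C>" for X
      using ch that by (auto simp: subset_chain_def \<F>_def)
    have "bl_filter (\<Union>\<C>)"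
      unfolding bl_filter_def
    proof (intro conjI ballI impI mult)
      show "\<Union>\<C> \<subseteq> carrier A" "\<one> \<in> \<Union>\<C>"
        using fil ne unfolding bl_filter_def by blast+
      show "y \<in> \<Union>\<C>" if "x \<in> \<Union>\<C>" "y \<in> carrier A" "x \<preceq> y" for x y
        using fil that unfolding bl_filter_def by blast
    qed auto
    then show "\<Union>\<C> \<in> \<F>"
      using fil by (auto simp: \<F>_def)
  qed
  then show ?thesis
    using that by (auto simp: \<F>_def)
qed

end

section \<open>The total preorder of a maximal filter\<close>

locale bl_maximal_filter = bl_algebra A for A (structure) +
  fixes F
  assumes filter: "bl_filter F"
    and zero_notin: "\<zero> \<notin> F"
    and maximal: "\<lbrakk>bl_filter G; \<zero> \<notin> G; F \<subseteq> G\<rbrakk> \<Longrightarrow> G = F"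
begin

lemma filter_one: "\<one> \<in> F"
  and filter_mult: "\<lbrakk>x \<in> F; y \<in> F\<rbrakk> \<Longrightarrow> x \<otimes> y \<in> F"
  and filter_up: "\<lbrakk>x \<in> F; x \<preceq> y; y \<in> carrier A\<rbrakk> \<Longrightarrow> y \<in> F"
  and filter_carrier: "x \<in> F \<Longrightarrow> x \<in> carrier A"
  using filter by (auto simp: bl_filter_def)

text \<open>The elements w with \<open>w \<curlyvee> v\<close> in F form a filter containing F and
  u. If v is not in F, this filter is proper because \<open>\<zero> \<curlyvee> v\<close> is v, so
  by maximality it equals F and u lies in F.\<close>

lemma filter_prime:
  assumes u: "u \<in> carrier A" and v: "v \<in> carrier A" and uv: "u \<curlyvee> v \<in> F"
  shows "u \<in> F \<or> v \<in> F"
proof (rule ccontr)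
  assume neg: "\<not> ?thesis"
  define G where "G = {w \<in> carrier A. w \<curlyvee> v \<in> F}"
  have "bl_filter G"
    unfolding bl_filter_def
  proof (intro conjI ballI impI)
    show "\<one> \<in> G"
      using filter_up[OF filter_one le_join1] v by (simp add: G_def)
    show "x \<otimes> y \<in> G" if "x \<in> G" "y \<in> G" for x y
      using that v filter_up[OF filter_mult join_mult_join_le, of x v y] by (auto simp: G_def)
    show "y \<in> G" if "x \<in> G" "y \<in> carrier A" "x \<preceq> y" for x y
    proof -
      have "x \<curlyvee> v \<preceq> y \<curlyvee> v"
        using that v le_trans[of x y "y \<curlyvee> v"]
        by (intro join_least) (auto simp: G_def le_join1 le_join2)
      then show ?thesis
        using that v filter_up by (auto simp: G_def)
    qed
  qed (auto simp: G_def)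
  moreover have "F \<subseteq> G"
    using v filter_carrier filter_up[OF _ le_join1] by (auto simp: G_def)
  moreover have "\<zero> \<notin> G"
    using neg v le_iff_join[of \<zero> v] zero_least[of v] by (auto simp: G_def)
  ultimately have "G = F"
    using maximal by blast
  then show False
    using neg u uv by (auto simp: G_def)
qed

text \<open>The order of the quotient of A by F, pulled back to A so that no classes have to be
  formed.\<close>

definition quot_le :: "'a \<Rightarrow> 'a \<Rightarrow> bool" (infix \<open>\<unlhd>\<close> 50)
  where "a \<unlhd> b \<longleftrightarrow> a \<leadsto> b \<in> F"

lemma quot_le_if_le: "\<lbrakk>a \<in> carrier A; b \<in> carrier A; a \<preceq> b\<rbrakk> \<Longrightarrow> a \<unlhd> b"
  by (simp add: quot_le_def filter_one le_iff_imp_eq_one)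

lemma quot_le_refl: "a \<in> carrier A \<Longrightarrow> a \<unlhd> a"
  by (simp add: quot_le_if_le le_refl)

lemma quot_le_total: "\<lbrakk>a \<in> carrier A; b \<in> carrier A\<rbrakk> \<Longrightarrow> a \<unlhd> b \<or> b \<unlhd> a"
  unfolding quot_le_def by (simp add: filter_prime filter_one prelinearity)

lemma quot_le_adjoint:
  "\<lbrakk>a \<in> carrier A; b \<in> carrier A; c \<in> carrier A\<rbrakk> \<Longrightarrow> c \<unlhd> a \<leadsto> b \<longleftrightarrow> a \<otimes> c \<unlhd> b"
  unfolding quot_le_def by (simp add: imp_imp m_comm)

text \<open>Residuation trades membership of an implication for a multiplier from F; monotonicity
  and transitivity then follow by multiplying the multipliers.\<close>

lemma quot_le_iff:
  assumes "a \<in> carrier A" "b \<in> carrier A"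
  shows "a \<unlhd> b \<longleftrightarrow> (\<exists>f\<in>F. f \<otimes> a \<preceq> b)"
proof
  assume "a \<unlhd> b"
  then show "\<exists>f\<in>F. f \<otimes> a \<preceq> b"
    using assms mult_imp_le[of a b] by (auto simp: quot_le_def m_comm intro: bexI[of _ "a \<leadsto> b"])
next
  assume "\<exists>f\<in>F. f \<otimes> a \<preceq> b"
  then obtain f where "f \<in> F" "f \<otimes> a \<preceq> b" by blast
  then have "f \<preceq> a \<leadsto> b"
    using assms by (simp add: residuation filter_carrier m_comm)
  then show "a \<unlhd> b"
    using assms \<open>f \<in> F\<close> filter_up by (auto simp: quot_le_def)
qed

lemma quot_le_mult_mono:
  assumes "a \<in> carrier A" "b \<in> carrier A" "c \<in> carrier A" "d \<in> carrier A" "a \<unlhd> b" "c \<unlhd> d"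
  shows "a \<otimes> c \<unlhd> b \<otimes> d"
proof -
  obtain f g where fg: "f \<in> F" "g \<in> F" "f \<otimes> a \<preceq> b" "g \<otimes> c \<preceq> d"
    using assms quot_le_iff[of a b] quot_le_iff[of c d] by auto
  then have "(f \<otimes> a) \<otimes> (g \<otimes> c) \<preceq> b \<otimes> d"
    using assms by (intro mult_mono) (auto simp: filter_carrier)
  moreover have "(f \<otimes> a) \<otimes> (g \<otimes> c) = (f \<otimes> g) \<otimes> (a \<otimes> c)"
    using assms fg by (simp add: filter_carrier m_ac)
  ultimately show ?thesis
    using assms fg quot_le_iff[of "a \<otimes> c" "b \<otimes> d"] filter_mult by auto
qed

lemma quot_le_trans:
  assumes "a \<in> carrier A" "b \<in> carrier A" "c \<in> carrier A" "a \<unlhd> b" "b \<unlhd> c"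
  shows "a \<unlhd> c"
proof -
  obtain f g where fg: "f \<in> F" "g \<in> F" "f \<otimes> a \<preceq> b" "g \<otimes> b \<preceq> c"
    using assms quot_le_iff[of a b] quot_le_iff[of b c] by auto
  then have "g \<otimes> (f \<otimes> a) \<preceq> g \<otimes> b"
    using assms by (intro mult_mono_right) (auto simp: filter_carrier)
  then have "(g \<otimes> f) \<otimes> a \<preceq> c"
    using assms fg le_trans[of "g \<otimes> (f \<otimes> a)" "g \<otimes> b" c] by (simp add: filter_carrier m_assoc)
  then show ?thesis
    using assms fg quot_le_iff[of a c] filter_mult by auto
qed

text \<open>By divisibility the right-hand product is \<open>a \<curlywedge> y\<close>, and the
  multiplier \<open>y \<leadsto> a\<close> from F pushes y below both a and y.\<close>

lemma quot_le_mult_imp: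
  assumes "a \<in> carrier A" "y \<in> carrier A" "y \<unlhd> a"
  shows "y \<unlhd> a \<otimes> (a \<leadsto> y)"
proof -
  have "(y \<leadsto> a) \<otimes> y \<preceq> a \<curlywedge> y"
    using assms mult_imp_le[of y a] mult_le2[of "y \<leadsto> a" y]
    by (intro meet_greatest) (auto simp: m_comm)
  then show ?thesis
    using assms quot_le_iff[of y "a \<otimes> (a \<leadsto> y)"] by (auto simp: divisibility quot_le_def)
qed

lemma mult_imp_quot_le: "\<lbrakk>a \<in> carrier A; y \<in> carrier A\<rbrakk> \<Longrightarrow> a \<otimes> (a \<leadsto> y) \<unlhd> y"
  by (simp add: quot_le_if_le mult_imp_le)

lemma one_quot_le_iff:
  assumes "x \<in> carrier A"
  shows "\<one> \<unlhd> x \<longleftrightarrow> x \<in> F"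
proof -
  have "\<one> \<leadsto> x = x"
    using assms mult_imp_le[of \<one> x] residuation[of \<one> x x]
    by (intro le_antisym) (auto simp: le_refl)
  then show ?thesis
    by (simp add: quot_le_def)
qed

text \<open>An Archimedean property: the elements above some power of x form a filter that contains
  F and also x, so by maximality it cannot be proper.\<close>

lemma pow_quot_le_zero:
  assumes x: "x \<in> carrier A" and "x \<notin> F"
  obtains n :: nat where "x [^] n \<unlhd> \<zero>"
proof -
  define G where "G = {w \<in> carrier A. \<exists>n::nat. x [^] n \<unlhd> w}"
  have "bl_filter G"
    unfolding bl_filter_def
  proof (intro conjI ballI impI)
    show "\<one> \<in> G"
      using quot_le_refl[of \<one>] by (auto simp: G_def intro: exI[of _ 0])
    show "a \<otimes> b \<in> G" if ab: "a \<in> G" "b \<in> G" for a b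
    proof -
      obtain m n :: nat where "x [^] m \<unlhd> a" "x [^] n \<unlhd> b" "a \<in> carrier A" "b \<in> carrier A"
        using ab unfolding G_def by blast
      then have "x [^] (m + n) \<unlhd> a \<otimes> b"
        using x quot_le_mult_mono[of "x [^] m" a "x [^] n" b] by (simp add: nat_pow_mult)
      then show ?thesis
        using that by (auto simp: G_def)
    qed
    show "b \<in> G" if "a \<in> G" "b \<in> carrier A" "a \<preceq> b" for a b
      using that x quot_le_trans[of _ a b] quot_le_if_le[of a b] unfolding G_def by blast
  qed (auto simp: G_def)
  moreover have "F \<subseteq> G"
  proof
    fix w assume "w \<in> F"
    then have "x [^] (0::nat) \<unlhd> w"
      by (simp add: one_quot_le_iff filter_carrier)
    then show "w \<in> G"
      using \<open>w \<in> F\<close> filter_carrier unfolding G_def by blast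
  qed
  moreover have "x \<in> G"
    using x quot_le_refl[of x] by (auto simp: G_def intro!: exI[of _ 1])
  ultimately have "\<zero> \<in> G"
    using maximal assms by blast
  then show ?thesis
    using that by (auto simp: G_def)
qed

section \<open>Approximate states\<close>

definition nilp :: "'a \<Rightarrow> nat"
  where "nilp z = (LEAST n. z [^] n \<unlhd> \<zero>)"

text \<open>The position of x on the descending scale of powers of z, which reaches zero at
  \<open>nilp z\<close> when z is not in F. The cap keeps the set finite even for x equivalent to
  zero, which lies below every power.\<close>

definition depth :: "'a \<Rightarrow> 'a \<Rightarrow> nat"
  where "depth z x = Max {k. k \<le> nilp z \<and> x \<unlhd> z [^] k}"

text \<open>Powers decrease, so all exponents beyond the least one work as well; that one exists is
  the Archimedean property.\<close>

lemma le_nilp_iff_pow: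
  assumes "z \<in> carrier A" "z \<notin> F"
  shows "nilp z \<le> n \<longleftrightarrow> z [^] n \<unlhd> \<zero>"
proof
  obtain m :: nat where "z [^] m \<unlhd> \<zero>"
    using assms pow_quot_le_zero by blast
  then have *: "z [^] nilp z \<unlhd> \<zero>"
    unfolding nilp_def by (rule LeastI)
  assume "nilp z \<le> n"
  then have "z [^] n = z [^] nilp z \<otimes> z [^] (n - nilp z)"
    using assms by (simp add: nat_pow_mult)
  then have "z [^] n \<unlhd> z [^] nilp z"
    using assms by (simp add: quot_le_if_le mult_le1)
  then show "z [^] n \<unlhd> \<zero>"
    using assms * quot_le_trans[of "z [^] n" "z [^] nilp z" \<zero>] by simp
qed (simp add: nilp_def Least_le)

lemma pow_quot_le_pow:
  assumes "z \<in> carrier A" "m \<le> (n::nat)"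
  shows "z [^] n \<unlhd> z [^] m"
proof -
  have "z [^] n = z [^] m \<otimes> z [^] (n - m)"
    using assms by (simp add: nat_pow_mult)
  then show ?thesis
    using assms by (simp add: quot_le_if_le mult_le1)
qed

lemma nilp_pos:
  assumes "z \<in> carrier A" "z \<notin> F"
  shows "nilp z > 0"
proof -
  have "\<not> z [^] (0::nat) \<unlhd> \<zero>"
    using zero_notin by (simp add: one_quot_le_iff)
  then show ?thesis
    using assms le_nilp_iff_pow[of z 0] by simp
qed

text \<open>Equality of two consecutive powers would propagate down to \<open>\<zero>\<close>.\<close>

lemma not_pow_quot_le_pow:
  assumes z: "z \<in> carrier A" "z \<notin> F" and mn: "m < n" "m < nilp z"
  shows "\<not> z [^] m \<unlhd> z [^] n"
proof
  assume *: "z [^] m \<unlhd> z [^] n"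
  have "z [^] m \<unlhd> z [^] (m + j)" for j
  proof (induction j)
    case 0
    show ?case using z by (simp add: quot_le_refl)
  next
    case (Suc j)
    have "z [^] m \<unlhd> z [^] Suc m"
      using z mn * pow_quot_le_pow[of z "Suc m" n] quot_le_trans[of "z [^] m" "z [^] n" "z [^] Suc m"]
      by simp
    then have "z [^] m \<otimes> z [^] j \<unlhd> z [^] Suc m \<otimes> z [^] j"
      using z by (intro quot_le_mult_mono) (auto simp: quot_le_refl)
    then have "z [^] (m + j) \<unlhd> z [^] (m + Suc j)"
      using z by (simp only: nat_pow_mult add_Suc_right add_Suc)
    then show ?case
      using Suc z quot_le_trans[of "z [^] m" "z [^] (m + j)" "z [^] (m + Suc j)"] by simp
  qed
  from this[of "nilp z - m"] have "z [^] m \<unlhd> z [^] nilp z"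
    using mn by simp
  then have "z [^] m \<unlhd> \<zero>"
    using z le_nilp_iff_pow[of z "nilp z"] quot_le_trans[of "z [^] m" "z [^] nilp z" \<zero>] by simp
  then show False
    using z mn le_nilp_iff_pow[of z m] by simp
qed

text \<open>The set under \<open>Max\<close> contains 0, as the zeroth power is the top, and is
  closed downwards, as powers decrease; so its maximum determines it.\<close>

lemma le_depth_iff:
  assumes "z \<in> carrier A" "x \<in> carrier A"
  shows "j \<le> depth z x \<longleftrightarrow> j \<le> nilp z \<and> x \<unlhd> z [^] j"
proof -
  let ?S = "{k. k \<le> nilp z \<and> x \<unlhd> z [^] k}"
  have fin: "finite ?S"
    by simp
  have "x \<unlhd> z [^] (0::nat)"
    using assms by (simp add: quot_le_if_le one_greatest)
  then have "0 \<in> ?S"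
    by simp
  then have mem: "depth z x \<in> ?S"
    unfolding depth_def using Max_in[OF fin] by blast
  show ?thesis
  proof
    assume "j \<le> depth z x"
    then show "j \<le> nilp z \<and> x \<unlhd> z [^] j"
      using mem assms pow_quot_le_pow[of z j "depth z x"]
        quot_le_trans[of x "z [^] depth z x" "z [^] j"] by auto
  next
    assume "j \<le> nilp z \<and> x \<unlhd> z [^] j"
    then show "j \<le> depth z x"
      unfolding depth_def using Max_ge[OF fin] by simp
  qed
qed

lemma depth_le_nilp: "\<lbrakk>z \<in> carrier A; x \<in> carrier A\<rbrakk> \<Longrightarrow> depth z x \<le> nilp z"
  using le_depth_iff[of z x "depth z x"] by simp

lemma quot_le_pow_depth: "\<lbrakk>z \<in> carrier A; x \<in> carrier A\<rbrakk> \<Longrightarrow> x \<unlhd> z [^] depth z x"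
  using le_depth_iff[of z x "depth z x"] by simp

lemma pow_Suc_depth_quot_le:
  assumes "z \<in> carrier A" "x \<in> carrier A" "depth z x < nilp z"
  shows "z [^] Suc (depth z x) \<unlhd> x"
  using assms le_depth_iff[of z x "Suc (depth z x)"] quot_le_total[of x "z [^] Suc (depth z x)"]
  by auto

lemma depth_zero:
  assumes "z \<in> carrier A"
  shows "depth z \<zero> = nilp z"
  using assms le_depth_iff[of z \<zero> "nilp z"] depth_le_nilp[of z \<zero>]
  by (simp add: quot_le_if_le zero_least)

text \<open>A positive depth would put x below z; since x is equivalent to the unit, z would then
  belong to F.\<close>

lemma depth_eq_0:
  assumes "z \<in> carrier A" "z \<notin> F" "x \<in> F"
  shows "depth z x = 0"
proof (rule ccontr)
  assume "depth z x \<noteq> 0"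
  then have "x \<unlhd> z"
    using assms le_depth_iff[of z x 1] by (simp add: filter_carrier)
  then show False
    using assms one_quot_le_iff quot_le_trans[of \<one> x z] filter_carrier by auto
qed

text \<open>When y is below a, it is equivalent to \<open>a \<otimes> (a \<leadsto> y)\<close>, and
  the exponents bounding the two factors add up.\<close>

lemma depth_add_imp_le:
  assumes z: "z \<in> carrier A" "z \<notin> F"
    and a: "a \<in> carrier A" and y: "y \<in> carrier A" and ya: "y \<unlhd> a"
  shows "depth z a + depth z (a \<leadsto> y) \<le> depth z y"
proof -
  let ?k = "depth z a" and ?l = "depth z (a \<leadsto> y)" and ?N = "nilp z"
  have "a \<otimes> (a \<leadsto> y) \<unlhd> z [^] ?k \<otimes> z [^] ?l"
    using z a y by (intro quot_le_mult_mono quot_le_pow_depth) auto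
  then have ykl: "y \<unlhd> z [^] (?k + ?l)"
    using z a y quot_le_mult_imp[OF a y ya]
      quot_le_trans[of y "a \<otimes> (a \<leadsto> y)" "z [^] (?k + ?l)"]
    by (simp add: nat_pow_mult)
  \<comment> \<open>The cap in \<open>depth\<close> has to be respected. If the sum exceeded N, then
    \<open>z [^] (N - k)\<close> would multiply a to zero, hence lie below
    \<open>a \<leadsto> y\<close> and so below \<open>z [^] l\<close> with l > N - k, against strict
    decrease of the powers.\<close>
  have "?k + ?l \<le> ?N"
  proof (rule ccontr)
    assume gt: "\<not> ?thesis"
    have le: "?k \<le> ?N" "?l \<le> ?N"
      using z a y by (auto intro: depth_le_nilp)
    have "a \<otimes> z [^] (?N - ?k) \<unlhd> z [^] ?k \<otimes> z [^] (?N - ?k)"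
      using z a by (intro quot_le_mult_mono quot_le_pow_depth) (auto simp: quot_le_refl)
    then have "a \<otimes> z [^] (?N - ?k) \<unlhd> z [^] ?N"
      using z le by (simp add: nat_pow_mult)
    then have "a \<otimes> z [^] (?N - ?k) \<unlhd> \<zero>"
      using z a le_nilp_iff_pow[of z ?N] quot_le_trans[of _ "z [^] ?N" \<zero>] by simp
    then have "a \<otimes> z [^] (?N - ?k) \<unlhd> y"
      using z a y quot_le_trans[of _ \<zero> y] by (simp add: quot_le_if_le zero_least)
    then have "z [^] (?N - ?k) \<unlhd> a \<leadsto> y"
      using z a y by (simp add: quot_le_adjoint)
    then have "z [^] (?N - ?k) \<unlhd> z [^] ?l"
      using z a y quot_le_pow_depth[of z "a \<leadsto> y"]
        quot_le_trans[of "z [^] (?N - ?k)" "a \<leadsto> y" "z [^] ?l"] by simp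
    then show False
      using not_pow_quot_le_pow[OF z, of "?N - ?k" ?l] gt le by linarith
  qed
  then show ?thesis
    using z y ykl by (simp add: le_depth_iff)
qed

text \<open>Bounding a and \<open>a \<leadsto> y\<close> from below requires the next power of z in
  each case; these two extra exponents are the error 2.\<close>

lemma depth_le_add_imp:
  assumes z: "z \<in> carrier A" "z \<notin> F" and a: "a \<in> carrier A" and y: "y \<in> carrier A"
  shows "depth z y \<le> depth z a + depth z (a \<leadsto> y) + 2"
proof (rule ccontr)
  let ?k = "depth z a" and ?l = "depth z (a \<leadsto> y)" and ?N = "nilp z"
  assume gt: "\<not> ?thesis"
  have yN: "depth z y \<le> ?N"
    using z y by (simp add: depth_le_nilp)
  \<comment> \<open>The negated claim puts both k and l strictly below \<open>depth z y\<close>,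
    hence below N, so the next powers are still within the cap.\<close>
  have "z [^] Suc ?k \<otimes> z [^] Suc ?l \<unlhd> a \<otimes> (a \<leadsto> y)"
    using z a y gt yN by (intro quot_le_mult_mono pow_Suc_depth_quot_le) auto
  then have "z [^] (?k + ?l + 2) \<unlhd> a \<otimes> (a \<leadsto> y)"
    using z by (simp only: nat_pow_mult) simp
  then have "z [^] (?k + ?l + 2) \<unlhd> y"
    using z a y mult_imp_quot_le[OF a y] quot_le_trans[of _ "a \<otimes> (a \<leadsto> y)" y]
    by simp
  then have "z [^] (?k + ?l + 2) \<unlhd> z [^] depth z y"
    using z y quot_le_pow_depth[of z y] quot_le_trans[of _ y "z [^] depth z y"] by simp
  then show False
    using not_pow_quot_le_pow[OF z, of "?k + ?l + 2" "depth z y"] gt yN by linarith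
qed

section \<open>Exact estimates at a coatom, unbounded nilpotency without one\<close>

definition coatom :: "'a \<Rightarrow> bool"
  where "coatom z \<longleftrightarrow> z \<in> carrier A \<and> z \<notin> F \<and> (\<forall>w \<in> carrier A. w \<notin> F \<longrightarrow> w \<unlhd> z)"

text \<open>If p, the power at the depth of x, were not below x, then \<open>p \<leadsto> x\<close>
  would be outside F and hence below the coatom z. So x, being below
  \<open>p \<otimes> (p \<leadsto> x)\<close>, would be below the next power, against the choice of
  the depth.\<close>

lemma pow_depth_quot_le:
  assumes "coatom z" and x: "x \<in> carrier A" and lt: "depth z x < nilp z"
  shows "z [^] depth z x \<unlhd> x"
proof (rule ccontr)
  let ?p = "z [^] depth z x"
  have z: "z \<in> carrier A" "z \<notin> F"
    using assms by (auto simp: coatom_def)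
  assume "\<not> ?p \<unlhd> x"
  then have "?p \<leadsto> x \<unlhd> z"
    using assms z by (simp add: coatom_def quot_le_def)
  then have "?p \<otimes> (?p \<leadsto> x) \<unlhd> ?p \<otimes> z"
    using z x by (intro quot_le_mult_mono) (auto simp: quot_le_refl)
  moreover have "x \<unlhd> ?p \<otimes> (?p \<leadsto> x)"
    using z x by (intro quot_le_mult_imp quot_le_pow_depth) auto
  ultimately have "x \<unlhd> z [^] Suc (depth z x)"
    using z x quot_le_trans[of x "?p \<otimes> (?p \<leadsto> x)" "?p \<otimes> z"] by simp
  then show False
    using z x lt le_depth_iff[of z x "Suc (depth z x)"] by simp
qed

text \<open>At a coatom the lower bounds use the powers at the depths themselves, so no exponent is
  lost.\<close>

lemma depth_le_add_imp_coatom: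
  assumes coatom: "coatom z" and a: "a \<in> carrier A" and y: "y \<in> carrier A"
  shows "depth z y \<le> depth z a + depth z (a \<leadsto> y)"
proof (rule ccontr)
  let ?k = "depth z a" and ?l = "depth z (a \<leadsto> y)" and ?N = "nilp z"
  have z: "z \<in> carrier A" "z \<notin> F"
    using assms by (auto simp: coatom_def)
  assume gt: "\<not> ?thesis"
  have yN: "depth z y \<le> ?N"
    using z y by (simp add: depth_le_nilp)
  have "z [^] ?k \<otimes> z [^] ?l \<unlhd> a \<otimes> (a \<leadsto> y)"
    using z a y gt yN coatom by (intro quot_le_mult_mono pow_depth_quot_le) auto
  then have "z [^] (?k + ?l) \<unlhd> a \<otimes> (a \<leadsto> y)"
    using z by (simp only: nat_pow_mult)
  then have "z [^] (?k + ?l) \<unlhd> y"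
    using z a y mult_imp_quot_le[OF a y] quot_le_trans[of _ "a \<otimes> (a \<leadsto> y)" y]
    by simp
  then have "z [^] (?k + ?l) \<unlhd> z [^] depth z y"
    using z y quot_le_pow_depth[of z y] quot_le_trans[of _ y "z [^] depth z y"] by simp
  then show False
    using not_pow_quot_le_pow[OF z, of "?k + ?l" "depth z y"] gt yN by linarith
qed

text \<open>Between \<open>z\<close> and \<open>\<one>\<close> choose \<open>w\<close>; the larger of \<open>w\<close> and \<open>w \<leadsto> z\<close> has a square above \<open>z\<close>.\<close>

lemma ex_larger_nilp:
  assumes "\<nexists>z. coatom z" and z: "z \<in> carrier A" "z \<notin> F"
  obtains v where "v \<in> carrier A" "v \<notin> F" "2 * nilp z \<le> nilp v + 1"
proof -
  obtain w where w: "w \<in> carrier A" "w \<notin> F" "\<not> w \<unlhd> z"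
    using assms by (auto simp: coatom_def)
  have u: "w \<leadsto> z \<in> carrier A" "w \<leadsto> z \<notin> F"
    using w z by (auto simp: quot_le_def)
  have "z \<unlhd> w"
    using w z quot_le_total by blast
  then have zw: "z \<unlhd> w \<otimes> (w \<leadsto> z)"
    using w z by (simp add: quot_le_mult_imp)
  obtain v where v: "v \<in> carrier A" "v \<notin> F" "w \<unlhd> v" "w \<leadsto> z \<unlhd> v"
    using quot_le_total[OF w(1) u(1)] w u quot_le_refl by blast
  have "w \<otimes> (w \<leadsto> z) \<unlhd> v \<otimes> v"
    using w u v by (intro quot_le_mult_mono) auto
  then have zv: "z \<unlhd> v \<otimes> v"
    using w z u v zw quot_le_trans[of z "w \<otimes> (w \<leadsto> z)" "v \<otimes> v"] by simp
  have pow: "z [^] j \<unlhd> v [^] (2 * j)" for j :: nat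
  proof (induction j)
    case (Suc j)
    have "z [^] j \<otimes> z \<unlhd> v [^] (2 * j) \<otimes> (v \<otimes> v)"
      using z v zv Suc by (intro quot_le_mult_mono) auto
    then show ?case
      using z v by (simp add: m_assoc)
  qed (simp add: quot_le_refl)
  \<comment> \<open>The exponent \<open>nilp z - 1\<close> is the last one at which the power of z
    is not below zero, so its double cannot annihilate v.\<close>
  have "\<not> nilp v \<le> 2 * (nilp z - 1)"
  proof
    assume "nilp v \<le> 2 * (nilp z - 1)"
    then have "v [^] (2 * (nilp z - 1)) \<unlhd> \<zero>"
      using v le_nilp_iff_pow by blast
    then have "z [^] (nilp z - 1) \<unlhd> \<zero>"
      using pow quot_le_trans[of _ "v [^] (2 * (nilp z - 1))" \<zero>] z v by simp
    then show False
      using z le_nilp_iff_pow[of z "nilp z - 1"] nilp_pos[of z] by simp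
  qed
  then show ?thesis
    using that v nilp_pos[OF z] by force
qed

lemma ex_nilp_gt:
  assumes "\<nexists>z. coatom z"
  shows "\<exists>z \<in> carrier A. z \<notin> F \<and> n < nilp z"
proof -
  \<comment> \<open>The passage from N to at least 2N - 1 is an increase only for N at least 2,
    hence the stronger bound n + 1 in the induction.\<close>
  have "\<exists>z \<in> carrier A. z \<notin> F \<and> n + 1 < nilp z"
  proof (induction n)
    case 0
    \<comment> \<open>Zero itself is not a coatom, which yields an element outside F and not below
      zero; its first power does not vanish.\<close>
    obtain z where z: "z \<in> carrier A" "z \<notin> F" "\<not> z \<unlhd> \<zero>"
      using assms zero_notin zero_closed unfolding coatom_def by blast
    then show ?case
      using le_nilp_iff_pow[of z 1] by auto
  next
    case (Suc n)
    then obtain z where z: "z \<in> carrier A" "z \<notin> F" "n + 1 < nilp z"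
      by blast
    then obtain v where "v \<in> carrier A" "v \<notin> F" "2 * nilp z \<le> nilp v + 1"
      using ex_larger_nilp[OF assms] by blast
    then show ?case
      using z(3) by force
  qed
  then show ?thesis
    by force
qed

end

section \<open>From approximate states to states by compactness\<close>

definition approx_states :: "('a, 'm) bl_structure_scheme \<Rightarrow> real \<Rightarrow> ('a \<Rightarrow> real) set"
  where "approx_states B \<epsilon> = {s. s \<zero>\<^bsub>B\<^esub> = 0 \<and> s \<one>\<^bsub>B\<^esub> = 1 \<and>
    (\<forall>x \<in> carrier B. \<forall>y \<in> carrier B.
      \<bar>s x + s (x \<leadsto>\<^bsub>B\<^esub> y) - (s y + s (y \<leadsto>\<^bsub>B\<^esub> x))\<bar> \<le> \<epsilon>)}"

lemma closed_approx_states: "closed (approx_states B \<epsilon>)"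
  unfolding approx_states_def
  unfolding Ball_def
  by (intro closed_Collect_conj closed_Collect_all closed_Collect_imp
      closed_Collect_eq closed_Collect_le continuous_intros open_Collect_const)
    simp_all

text \<open>Tychonoff's theorem. Indexing by the whole type places the cube in the function space
  where \<open>approx_states\<close> is closed.\<close>

lemma compact_unit_cube: "compact (UNIV \<rightarrow>\<^sub>E {0..1::real})"
  using compactin_PiE[of "\<lambda>_. euclideanreal" UNIV "\<lambda>_. {0..1}"]
  by (simp add: euclidean_product_topology)

context bl_maximal_filter
begin

text \<open>By totality one may take y below x. Then \<open>y \<leadsto> x\<close> has depth 0, and
  the defect of the state equation is the defect of additivity of the depth, divided by
  \<open>nilp z\<close>; it lies between 0 and c.\<close>

lemma approx_state_depth:
  assumes z: "z \<in> carrier A" "z \<notin> F"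
    and c: "\<And>a y. \<lbrakk>a \<in> carrier A; y \<in> carrier A\<rbrakk>
      \<Longrightarrow> depth z y \<le> depth z a + depth z (a \<leadsto> y) + c"
  shows "(\<lambda>x. 1 - depth z x / nilp z) \<in> approx_states A (c / nilp z)" (is "?s \<in> _")
proof -
  have N: "real (nilp z) > 0"
    using nilp_pos[OF z] by simp
  have *: "\<bar>?s x + ?s (x \<leadsto> y) - (?s y + ?s (y \<leadsto> x))\<bar> \<le> c / nilp z"
    if xy: "x \<in> carrier A" "y \<in> carrier A" and le: "y \<unlhd> x" for x y
  proof -
    let ?d = "real (depth z y) - real (depth z x) - real (depth z (x \<leadsto> y))"
    have "depth z (y \<leadsto> x) = 0"
      using z le by (intro depth_eq_0) (auto simp: quot_le_def)
    then have "?s x + ?s (x \<leadsto> y) - (?s y + ?s (y \<leadsto> x)) = ?d / nilp z"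
      by (simp add: diff_divide_distrib)
    moreover have "0 \<le> ?d" "?d \<le> c"
      using depth_add_imp_le[OF z xy le] c[OF xy] by linarith+
    ultimately show ?thesis
      using N by (simp add: divide_right_mono)
  qed
  have "\<bar>?s x + ?s (x \<leadsto> y) - (?s y + ?s (y \<leadsto> x))\<bar> \<le> c / nilp z"
    if xy: "x \<in> carrier A" "y \<in> carrier A" for x y
    using quot_le_total[OF xy] *[OF xy] *[OF xy(2,1)] by (auto simp: abs_minus_commute)
  moreover have "?s \<zero> = 0" "?s \<one> = 1"
    using z N by (simp_all add: depth_zero depth_eq_0 filter_one)
  ultimately show ?thesis
    by (simp add: approx_states_def)
qed

lemma ex_approx_state:
  assumes "\<epsilon> > 0"
  shows "(UNIV \<rightarrow>\<^sub>E {0..1}) \<inter> approx_states A \<epsilon> \<noteq> {}"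
proof -
  obtain z and c :: nat where z: "z \<in> carrier A" "z \<notin> F" and c: "c / nilp z \<le> \<epsilon>"
    "\<And>a y. \<lbrakk>a \<in> carrier A; y \<in> carrier A\<rbrakk> \<Longrightarrow> depth z y \<le> depth z a + depth z (a \<leadsto> y) + c"
  proof (cases "\<exists>z. coatom z")
    case True
    then obtain z where "coatom z" by blast
    \<comment> \<open>The error constant is 0 here, so the state equation is exact for any value of
      \<open>nilp z\<close>.\<close>
    then show thesis
      using that[of z 0] assms depth_le_add_imp_coatom by (auto simp: coatom_def)
  next
    case False
    \<comment> \<open>The error constant is 2, and a value of \<open>nilp z\<close> above
      \<open>2 / \<epsilon>\<close> makes the defect small enough.\<close>
    obtain n :: nat where n: "2 / \<epsilon> < n"
      using reals_Archimedean2 by blast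
    obtain z where z: "z \<in> carrier A" "z \<notin> F" "n < nilp z"
      using ex_nilp_gt[OF False] by blast
    have "2 / \<epsilon> < nilp z"
      using n z(3) by simp
    then have "2 / nilp z \<le> \<epsilon>"
      using assms z(3) by (simp add: field_simps)
    then show thesis
      using that[of z 2] z depth_le_add_imp by simp
  qed
  define f where "f = (\<lambda>x. 1 - depth z x / nilp z)"
  \<comment> \<open>The depth is controlled only on the carrier; the value 0 elsewhere keeps s in
    the cube over the whole type.\<close>
  define s where "s = (\<lambda>x. if x \<in> carrier A then f x else 0)"
  have "s \<in> approx_states A (c / nilp z)"
    using approx_state_depth[OF z c(2)] by (simp add: approx_states_def s_def flip: f_def)
  then have "s \<in> approx_states A \<epsilon>"
    using c(1) by (force simp: approx_states_def)
  moreover have "s \<in> UNIV \<rightarrow>\<^sub>E {0..1}"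
    using depth_le_nilp[OF z(1)] nilp_pos[OF z] by (auto simp: s_def f_def)
  ultimately show ?thesis
    by blast
qed

end

lemma (in bl_algebra) states_nonempty:
  assumes "\<zero> \<noteq> \<one>"
  shows "states A \<noteq> {}"
proof -
  obtain F where "bl_filter F" "\<zero> \<notin> F" "\<And>G. \<lbrakk>bl_filter G; \<zero> \<notin> G; F \<subseteq> G\<rbrakk> \<Longrightarrow> G = F"
    using ex_maximal_filter[OF assms] by blast
  then interpret bl_maximal_filter A F
    by unfold_locales
  have "(UNIV \<rightarrow>\<^sub>E {0..1}) \<inter> (\<Inter>\<epsilon>\<in>{0<..}. approx_states A \<epsilon>) \<noteq> {}"
  proof (rule compact_imp_fip_image[OF compact_unit_cube closed_approx_states])
    fix I :: "real set" assume I: "finite I" "I \<subseteq> {0<..}"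
    show "(UNIV \<rightarrow>\<^sub>E {0..1}) \<inter> (\<Inter>\<epsilon>\<in>I. approx_states A \<epsilon>) \<noteq> {}"
    proof -
      \<comment> \<open>Inserting 1 gives a minimum also when I is empty.\<close>
      define \<delta> where "\<delta> = Min (insert 1 I)"
      have "\<delta> > 0"
        using I by (auto simp: \<delta>_def)
      moreover have "approx_states A \<delta> \<subseteq> (\<Inter>\<epsilon>\<in>I. approx_states A \<epsilon>)"
      proof (rule INT_greatest)
        fix \<epsilon> assume "\<epsilon> \<in> I"
        then have "\<delta> \<le> \<epsilon>"
          using I by (simp add: \<delta>_def)
        then show "approx_states A \<delta> \<subseteq> approx_states A \<epsilon>"
          by (force simp: approx_states_def)
      qed
      ultimately show ?thesis
        using ex_approx_state by blast
    qed
  qed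
  then obtain s where s: "s \<in> UNIV \<rightarrow>\<^sub>E {0..1}" "\<And>\<epsilon>. \<epsilon> > 0 \<Longrightarrow> s \<in> approx_states A \<epsilon>"
    by auto
  have "s x + s (x \<leadsto> y) = s y + s (y \<leadsto> x)" if "x \<in> carrier A" "y \<in> carrier A" for x y
  proof -
    have "\<bar>s x + s (x \<leadsto> y) - (s y + s (y \<leadsto> x))\<bar> \<le> 0"
    proof (rule field_le_epsilon)
      show "\<bar>s x + s (x \<leadsto> y) - (s y + s (y \<leadsto> x))\<bar> \<le> 0 + \<epsilon>" if "\<epsilon> > 0" for \<epsilon>
        using s(2)[OF that] \<open>x \<in> carrier A\<close> \<open>y \<in> carrier A\<close> by (simp add: approx_states_def)
    qed
    then show ?thesis
      by simp
  qed
  moreover have "s \<zero> = 0" "s \<one> = 1"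
    using s(2)[of 1] by (auto simp: approx_states_def)
  ultimately have "restrict s (carrier A) \<in> states A"
    using s(1) by (auto simp: states_def PiE_iff)
  then show ?thesis
    by blast
qed

section \<open>Compatible states\<close>

context state_bl_algebra
begin

lemma sigma_one: "\<sigma> \<one> = \<one>"
  using sigma_imp[of \<zero> \<zero>] imp_self[of \<zero>] le_refl[of \<zero>]
  by (simp add: sigma_zero bl_le_def)

text \<open>The case of the second factor \<one> in \<open>sigma_sigma_mult\<close>, as \<sigma>
  fixes \<one>.\<close>

lemma sigma_idem:
  assumes "x \<in> carrier A"
  shows "\<sigma> (\<sigma> x) = \<sigma> x"
  using sigma_sigma_mult[of x \<one>] assms by (simp add: sigma_one sigma_closed)

text \<open>Divisibility writes the meet as a product with left factor x, and
  \<open>sigma_mult\<close> then splits off the factor \<open>\<sigma> x\<close>.\<close>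

lemma sigma_meet_le:
  assumes "x \<in> carrier A" "y \<in> carrier A"
  shows "\<sigma> (x \<curlywedge> y) \<preceq> \<sigma> x"
  using assms by (simp add: divisibility sigma_mult sigma_closed mult_le1)

lemma compatible_states_eq_sigma:
  assumes "s \<in> compatible_states A \<sigma>" "x \<in> carrier A"
  shows "s (\<sigma> x) = s x"
  using assms sigma_idem[of x] sigma_closed[of x] unfolding compatible_states_def by blast

lemma restrict_compatible_state:
  assumes "s \<in> compatible_states A \<sigma>"
  shows "restrict s (\<sigma> ` carrier A) \<in> states (image_algebra A \<sigma>)"
proof -
  interpret B: bl_algebra "image_algebra A \<sigma>"
    by (rule bl_algebra_image)
  have "x \<leadsto> y \<in> \<sigma> ` carrier A" if "x \<in> \<sigma> ` carrier A" "y \<in> \<sigma> ` carrier A" for x y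
    using B.imp_closed that by (simp add: image_algebra_def)
  moreover have "\<zero> \<in> \<sigma> ` carrier A" "\<one> \<in> \<sigma> ` carrier A"
    using B.zero_closed B.one_closed by (simp_all add: image_algebra_def)
  ultimately show ?thesis
    using assms sigma_closed
    by (auto simp: compatible_states_def states_def image_algebra_def PiE_iff)
qed

text \<open>Since \<sigma> need not preserve implications, the state equation of t is applied to
  \<open>\<sigma> x\<close> and \<open>\<sigma> (x \<curlywedge> y)\<close>. The reverse implication
  between them is \<one>, which leaves an expression symmetric in x and y.\<close>

lemma compose_sigma_compatible_state:
  assumes t: "t \<in> states (image_algebra A \<sigma>)"
  shows "(\<lambda>x \<in> carrier A. t (\<sigma> x)) \<in> compatible_states A \<sigma>"
proof -
  have t_eq: "t x + t (x \<leadsto> y) = t y + t (y \<leadsto> x)" if "x \<in> \<sigma> ` carrier A" "y \<in> \<sigma> ` carrier A" for x y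
    using t that by (auto simp: states_def image_algebra_def)
  have t01: "t \<zero> = 0" "t \<one> = 1"
    using t by (simp_all add: states_def image_algebra_def)
  have t_rng: "t (\<sigma> x) \<in> {0..1}" if "x \<in> carrier A" for x
    using t that by (auto simp: states_def image_algebra_def)
  have *: "t (\<sigma> x) + t (\<sigma> (x \<leadsto> y)) = t (\<sigma> (x \<curlywedge> y)) + 1"
    if "x \<in> carrier A" "y \<in> carrier A" for x y
  proof -
    have "\<sigma> (x \<curlywedge> y) \<leadsto> \<sigma> x = \<one>"
      using that sigma_meet_le[of x y] by (simp add: le_iff_imp_eq_one sigma_closed)
    then show ?thesis
      using that t_eq[of "\<sigma> x" "\<sigma> (x \<curlywedge> y)"] by (simp add: sigma_imp t01)
  qed
  have "t (\<sigma> x) + t (\<sigma> (x \<leadsto> y)) = t (\<sigma> y) + t (\<sigma> (y \<leadsto> x))"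
    if "x \<in> carrier A" "y \<in> carrier A" for x y
    using *[OF that] *[OF that(2,1)] that by (simp add: meet_comm)
  then show ?thesis
    using t01 t_rng by (auto simp: compatible_states_def states_def sigma_zero sigma_one)
qed

lemma affine_homeomorphism_restrict:
  "affine_homeomorphism A (compatible_states A \<sigma>)
     (image_algebra A \<sigma>) (states (image_algebra A \<sigma>)) (\<lambda>s. restrict s (\<sigma> ` carrier A))"
  (is "affine_homeomorphism _ ?S ?B ?T ?\<Phi>")
proof -
  let ?\<Psi> = "\<lambda>t. \<lambda>x \<in> carrier A. t (\<sigma> x)"
  have carB [simp]: "carrier ?B = \<sigma> ` carrier A"
    by (simp add: image_algebra_def)
  have S: "?S \<subseteq> extensional (carrier A)"
    by (auto simp: compatible_states_def states_def PiE_iff)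
  have T: "?T \<subseteq> extensional (\<sigma> ` carrier A)"
    by (auto simp: states_def PiE_iff)
  have topS: "topspace (weak_topology A ?S) = ?S" and topT: "topspace (weak_topology ?B ?T) = ?T"
    using S T by (auto simp: weak_topology_def PiE_def)
  have coordS: "continuous_map (weak_topology A ?S) euclideanreal (\<lambda>s. s x)"
    if "x \<in> carrier A" for x
    unfolding weak_topology_def
    using that continuous_map_product_projection by (intro continuous_map_from_subtopology) fast
  have coordT: "continuous_map (weak_topology ?B ?T) euclideanreal (\<lambda>s. s x)"
    if "x \<in> \<sigma> ` carrier A" for x
    unfolding weak_topology_def
    using that continuous_map_product_projection[of x "\<sigma> ` carrier A" "\<lambda>_. euclideanreal"]
    by (intro continuous_map_from_subtopology) simp
  have "continuous_map (weak_topology A ?S) (weak_topology ?B ?T) ?\<Phi>"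
    unfolding weak_topology_def[of ?B] continuous_map_in_subtopology continuous_map_componentwise
    using restrict_compatible_state coordS sigma_closed
    by (auto simp: topS intro!: coordS)
  \<comment> \<open>The coordinate at x of the image of t is the coordinate of t at
    \<open>\<sigma> x\<close>, so continuity is checked coordinatewise.\<close>
  moreover have "continuous_map (weak_topology ?B ?T) (weak_topology A ?S) ?\<Psi>"
    unfolding weak_topology_def[of A] continuous_map_in_subtopology continuous_map_componentwise
    using compose_sigma_compatible_state
    by (auto simp: topT intro!: coordT)
  moreover have "?\<Psi> (?\<Phi> s) = s" if "s \<in> ?S" for s
    using that S compatible_states_eq_sigma
    by (intro extensionalityI[of _ "carrier A"]) auto
  moreover have "?\<Phi> (?\<Psi> t) = t" if "t \<in> ?T" for t
    using that T sigma_closed sigma_idem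
    by (intro extensionalityI[of _ "\<sigma> ` carrier A"]) auto
  ultimately have "homeomorphic_maps (weak_topology A ?S) (weak_topology ?B ?T) ?\<Phi> ?\<Psi>"
    by (simp add: homeomorphic_maps_def topS topT)
  then have "homeomorphic_map (weak_topology A ?S) (weak_topology ?B ?T) ?\<Phi>"
    using homeomorphic_maps_imp_map by blast
  moreover have "?\<Phi> (convex_comb A r s t) = convex_comb ?B r (?\<Phi> s) (?\<Phi> t)" for r s t
    using sigma_closed by (auto simp: convex_comb_def restrict_def fun_eq_iff)
  ultimately show ?thesis
    by (simp add: affine_homeomorphism_def)
qed

text \<open>A state on A might fail to be compatible, so existence is applied to the image algebra,
  which shares \<zero> and \<one> with A, and the state is pulled back along \<sigma>.\<close>

lemma compatible_states_nonempty:
  assumes "\<zero> \<noteq> \<one>"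
  shows "compatible_states A \<sigma> \<noteq> {}"
proof -
  have "states (image_algebra A \<sigma>) \<noteq> {}"
    using assms bl_algebra.states_nonempty[OF bl_algebra_image] by (simp add: image_algebra_def)
  then show ?thesis
    using compose_sigma_compatible_state by blast
qed

end

theorem theorem6p4:
  fixes A (structure) and \<sigma> :: "'a \<Rightarrow> 'a"
  assumes "state_bl_algebra A \<sigma>"
    and "\<zero> \<noteq> \<one>"
  shows "compatible_states A \<sigma> \<noteq> {} \<and>
    (\<exists>\<Phi>. affine_homeomorphism A (compatible_states A \<sigma>)
       (image_algebra A \<sigma>) (states (image_algebra A \<sigma>)) \<Phi>)"
proof -
  interpret state_bl_algebra A \<sigma> by fact
  show ?thesis
    using compatible_states_nonempty[OF assms(2)] affine_homeomorphism_restrict by blast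
qed

end
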